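(* Let $X$ be a locale and $R$ a localic relation on $X$ with open cones. Then the induced cones $\Uparrow_R,\Downarrow_R\colon\mathcal{O}X\to\mathcal{O}X$ preserve all joins.
   Context: The category of locales is the opposite of the category of frames: a locale $X$ has a frame of opens $\mathcal{O}X$, and a map $f\colon X\to Y$ is a frame map $f^{-1}\colon\mathcal{O}Y\to\mathcal{O}X$ (preserving finite meets and all joins). A localic relation on $X$ is a sublocale (extremal monomorphism, equivalently a map whose frame map is surjective) $r\colon R\rightarrowtail X\times X$; its source and target maps are $s=\mathrm{pr}_1\circ r$, $t=\mathrm{pr}_2\circ r\colon R\to X$. A locale map $f\colon X\to Y$ is open if $f^{-1}$ has a left adjoint $f_!$ with $f_!(U\wedge f^{-1}(V))=f_!(U)\wedge V$. $R$ has open cones if $s,t$ are open; then its induced cones are $\Uparrow_R:=t_!s^{-1}$ and $\Downarrow_R:=s_!t^{-1}\colon\mathcal{O}X\to\mathcal{O}X$. *)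

theory Defs
  imports Main
begin

text \<open>A locale is given by its frame of opens, a type of class \<open>frame\<close>. A locale map
  \<open>f : X \<rightarrow> Y\<close> is represented by its frame map \<open>f\<^sup>-\<^sup>1\<close>, a function from the opens of \<open>Y\<close> to the
  opens of \<open>X\<close>; composition of locale maps is composition of frame maps in the reverse order.
  The library class \<open>complete_distrib_lattice\<close> demands complete distributivity, which is stronger
  than the frame law.\<close>

class frame = complete_lattice +
  assumes inf_Sup_frame: "inf a (Sup B) = (SUP b\<in>B. inf a b)"

definition preserves_joins :: "('a::complete_lattice \<Rightarrow> 'b::complete_lattice) \<Rightarrow> bool" where
  "preserves_joins f \<longleftrightarrow> (\<forall>A. f (Sup A) = (SUP a\<in>A. f a))"

definition frame_hom :: "('a::frame \<Rightarrow> 'b::frame) \<Rightarrow> bool" where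
  "frame_hom f \<longleftrightarrow> f top = top \<and> (\<forall>a b. f (inf a b) = inf (f a) (f b)) \<and> preserves_joins f"

definition left_adjoint :: "('a::order \<Rightarrow> 'b::order) \<Rightarrow> ('b \<Rightarrow> 'a) \<Rightarrow> bool" where
  "left_adjoint l f \<longleftrightarrow> (\<forall>x y. l x \<le> y \<longleftrightarrow> x \<le> f y)"

lemma left_adjoint_unique:
  assumes "left_adjoint l f" "left_adjoint l' f"
  shows "l = l'"
  using assms unfolding left_adjoint_def by (intro ext antisym) (metis order.refl)+

text \<open>In the following two definitions the argument \<open>f\<close> is the inverse image map \<open>f\<^sup>-\<^sup>1\<close>;
  \<open>direct_image f\<close> is \<open>f\<^sub>!\<close>, and is meaningful only when the left adjoint exists.\<close>

definition open_map :: "('a::frame \<Rightarrow> 'b::frame) \<Rightarrow> bool" where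
  "open_map f \<longleftrightarrow> frame_hom f \<and>
    (\<exists>l. left_adjoint l f \<and> (\<forall>U V. l (inf U (f V)) = inf (l U) V))"

definition direct_image :: "('a::frame \<Rightarrow> 'b::frame) \<Rightarrow> 'b \<Rightarrow> 'a" where
  "direct_image f = (THE l. left_adjoint l f)"

text \<open>The product locale, i.e. the coproduct of frames, in its standard construction: opens are the
  down-sets of pairs that are closed under arbitrary (also empty) joins in each coordinate.
  The universal property is established below.\<close>

definition bi_ideal :: "('a::frame \<times> 'b::frame) set \<Rightarrow> bool" where
  "bi_ideal I \<longleftrightarrow>
    (\<forall>a b a' b'. (a, b) \<in> I \<and> a' \<le> a \<and> b' \<le> b \<longrightarrow> (a', b') \<in> I) \<and>
    (\<forall>A b. (\<forall>a\<in>A. (a, b) \<in> I) \<longrightarrow> (Sup A, b) \<in> I) \<and>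
    (\<forall>a B. (\<forall>b\<in>B. (a, b) \<in> I) \<longrightarrow> (a, Sup B) \<in> I)"

lemma bi_idealI:
  assumes "\<And>a b a' b'. (a, b) \<in> I \<Longrightarrow> a' \<le> a \<Longrightarrow> b' \<le> b \<Longrightarrow> (a', b') \<in> I"
    and "\<And>A b. (\<And>a. a \<in> A \<Longrightarrow> (a, b) \<in> I) \<Longrightarrow> (Sup A, b) \<in> I"
    and "\<And>a B. (\<And>b. b \<in> B \<Longrightarrow> (a, b) \<in> I) \<Longrightarrow> (a, Sup B) \<in> I"
  shows "bi_ideal I"
  unfolding bi_ideal_def
proof (intro conjI allI impI)
  show "(a', b') \<in> I" if "(a, b) \<in> I \<and> a' \<le> a \<and> b' \<le> b" for a b a' b'
    using that by (intro assms(1)[of a b a' b']) simp_all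
  show "(Sup A, b) \<in> I" if "\<forall>a\<in>A. (a, b) \<in> I" for A b
    by (rule assms(2)) (rule bspec[OF that])
  show "(a, Sup B) \<in> I" if "\<forall>b\<in>B. (a, b) \<in> I" for a B
    by (rule assms(3)) (rule bspec[OF that])
qed

lemma bi_ideal_down: "bi_ideal I \<Longrightarrow> (a, b) \<in> I \<Longrightarrow> a' \<le> a \<Longrightarrow> b' \<le> b \<Longrightarrow> (a', b') \<in> I"
  unfolding bi_ideal_def by (drule conjunct1) iprover

lemma bi_ideal_Sup1: "bi_ideal I \<Longrightarrow> (\<And>a. a \<in> A \<Longrightarrow> (a, b) \<in> I) \<Longrightarrow> (Sup A, b) \<in> I"
  by (simp add: bi_ideal_def)

lemma bi_ideal_Sup2: "bi_ideal I \<Longrightarrow> (\<And>b. b \<in> B \<Longrightarrow> (a, b) \<in> I) \<Longrightarrow> (a, Sup B) \<in> I"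
  by (simp add: bi_ideal_def)

lemma bi_ideal_bot:
  assumes "bi_ideal I"
  shows "(bot, b) \<in> I" "(a, bot) \<in> I"
  using bi_ideal_Sup1[OF assms, of "{}" b] bi_ideal_Sup2[OF assms, of "{}" a] by simp_all

lemma bi_ideal_Inter: "(\<And>I. I \<in> S \<Longrightarrow> bi_ideal I) \<Longrightarrow> bi_ideal (\<Inter>S)"
  by (rule bi_idealI) (auto intro: bi_ideal_down bi_ideal_Sup1 bi_ideal_Sup2)

typedef (overloaded) ('a, 'b) product_opens = "{I :: ('a::frame \<times> 'b::frame) set. bi_ideal I}"
  morphisms pairs_of Abs_product_opens
  by (rule exI[of _ UNIV]) (simp add: bi_ideal_def)

setup_lifting type_definition_product_opens

instantiation product_opens :: (frame, frame) complete_lattice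
begin

lift_definition less_eq_product_opens :: "('a, 'b) product_opens \<Rightarrow> ('a, 'b) product_opens \<Rightarrow> bool"
  is "(\<subseteq>)" .

lift_definition less_product_opens :: "('a, 'b) product_opens \<Rightarrow> ('a, 'b) product_opens \<Rightarrow> bool"
  is "(\<subset>)" .

lift_definition inf_product_opens ::
  "('a, 'b) product_opens \<Rightarrow> ('a, 'b) product_opens \<Rightarrow> ('a, 'b) product_opens"
  is "(\<inter>)"
  using bi_ideal_Inter[of "{I, J}" for I J] by fastforce

lift_definition Inf_product_opens :: "('a, 'b) product_opens set \<Rightarrow> ('a, 'b) product_opens"
  is "\<lambda>S. \<Inter>S"
  by (rule bi_ideal_Inter) blast

lift_definition top_product_opens :: "('a, 'b) product_opens" is UNIV
  by (simp add: bi_ideal_def)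

definition sup_product_opens ::
  "('a, 'b) product_opens \<Rightarrow> ('a, 'b) product_opens \<Rightarrow> ('a, 'b) product_opens"
  where "sup_product_opens I J = Inf {K. I \<le> K \<and> J \<le> K}"

definition Sup_product_opens :: "('a, 'b) product_opens set \<Rightarrow> ('a, 'b) product_opens"
  where "Sup_product_opens S = Inf {K. \<forall>I\<in>S. I \<le> K}"

definition bot_product_opens :: "('a, 'b) product_opens"
  where "bot_product_opens = Inf UNIV"

instance
proof
  fix x y z :: "('a, 'b) product_opens" and A :: "('a, 'b) product_opens set"
  have low: "a \<in> S \<Longrightarrow> Inf S \<le> a" and grt: "(\<And>a. a \<in> S \<Longrightarrow> c \<le> a) \<Longrightarrow> c \<le> Inf S"
    for a c :: "('a, 'b) product_opens" and S
    by (transfer; blast)+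
  show "(x < y) = (x \<le> y \<and> \<not> y \<le> x)" by transfer blast
  show "x \<le> x" by transfer blast
  show "x \<le> y \<Longrightarrow> y \<le> z \<Longrightarrow> x \<le> z" by transfer blast
  show "x \<le> y \<Longrightarrow> y \<le> x \<Longrightarrow> x = y" by transfer blast
  show "inf x y \<le> x" "inf x y \<le> y" by (transfer; blast)+
  show "x \<le> y \<Longrightarrow> x \<le> z \<Longrightarrow> x \<le> inf y z" by transfer blast
  show "x \<le> sup x y" "y \<le> sup x y" unfolding sup_product_opens_def by (rule grt; simp)+
  show "y \<le> x \<Longrightarrow> z \<le> x \<Longrightarrow> sup y z \<le> x" unfolding sup_product_opens_def by (rule low) simp
  show "x \<in> A \<Longrightarrow> Inf A \<le> x" by (rule low)
  show "(\<And>x. x \<in> A \<Longrightarrow> z \<le> x) \<Longrightarrow> z \<le> Inf A" by (rule grt)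
  show "x \<in> A \<Longrightarrow> x \<le> Sup A" unfolding Sup_product_opens_def by (rule grt) simp
  show "(\<And>x. x \<in> A \<Longrightarrow> x \<le> z) \<Longrightarrow> Sup A \<le> z" unfolding Sup_product_opens_def by (rule low) simp
  show "Inf {} = (top :: ('a, 'b) product_opens)" by transfer simp
  show "Sup {} = (bot :: ('a, 'b) product_opens)"
    by (simp add: Sup_product_opens_def bot_product_opens_def)
qed

end

lemma SUP_inf_frame: "inf (Sup B) a = (SUP b\<in>B. inf b (a::'a::frame))"
  by (simp add: inf_commute[of _ a] inf_Sup_frame)

text \<open>Heyting implication of bi-ideals, used only to verify the frame law.\<close>

lift_definition product_imp ::
  "('a::frame, 'b::frame) product_opens \<Rightarrow> ('a, 'b) product_opens \<Rightarrow> ('a, 'b) product_opens"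
  is "\<lambda>J K. {(a, b). \<forall>c d. (c, d) \<in> J \<longrightarrow> (inf a c, inf b d) \<in> K}"
proof -
  fix J K :: "('a \<times> 'b) set"
  assume K: "bi_ideal K"
  show "bi_ideal {(a, b). \<forall>c d. (c, d) \<in> J \<longrightarrow> (inf a c, inf b d) \<in> K}"
  proof (rule bi_idealI)
    fix a a' :: 'a and b b' :: 'b
    assume "(a, b) \<in> {(a, b). \<forall>c d. (c, d) \<in> J \<longrightarrow> (inf a c, inf b d) \<in> K}" "a' \<le> a" "b' \<le> b"
    then show "(a', b') \<in> {(a, b). \<forall>c d. (c, d) \<in> J \<longrightarrow> (inf a c, inf b d) \<in> K}"
      by (auto intro: bi_ideal_down[OF K] inf_mono)
  next
    fix A :: "'a set" and b :: 'b
    assume "\<And>a. a \<in> A \<Longrightarrow> (a, b) \<in> {(a, b). \<forall>c d. (c, d) \<in> J \<longrightarrow> (inf a c, inf b d) \<in> K}"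
    then show "(Sup A, b) \<in> {(a, b). \<forall>c d. (c, d) \<in> J \<longrightarrow> (inf a c, inf b d) \<in> K}"
      by (auto simp: SUP_inf_frame intro!: bi_ideal_Sup1[OF K])
  next
    fix a :: 'a and B :: "'b set"
    assume "\<And>b. b \<in> B \<Longrightarrow> (a, b) \<in> {(a, b). \<forall>c d. (c, d) \<in> J \<longrightarrow> (inf a c, inf b d) \<in> K}"
    then show "(a, Sup B) \<in> {(a, b). \<forall>c d. (c, d) \<in> J \<longrightarrow> (inf a c, inf b d) \<in> K}"
      by (auto simp: SUP_inf_frame intro!: bi_ideal_Sup2[OF K])
  qed
qed

lemma product_imp_iff: "I \<le> product_imp J K \<longleftrightarrow> inf J I \<le> K"
proof transfer
  fix I J K :: "('a \<times> 'b) set"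
  assume "bi_ideal I" "bi_ideal J" "bi_ideal K"
  show "I \<subseteq> {(a, b). \<forall>c d. (c, d) \<in> J \<longrightarrow> (inf a c, inf b d) \<in> K} \<longleftrightarrow> J \<inter> I \<subseteq> K"
  proof
    assume "I \<subseteq> {(a, b). \<forall>c d. (c, d) \<in> J \<longrightarrow> (inf a c, inf b d) \<in> K}"
    then have "(inf a a, inf b b) \<in> K" if "(a, b) \<in> I" "(a, b) \<in> J" for a b
      using that by blast
    then show "J \<inter> I \<subseteq> K" by auto
  next
    assume "J \<inter> I \<subseteq> K"
    moreover have "(inf a c, inf b d) \<in> J \<inter> I" if "(a, b) \<in> I" "(c, d) \<in> J" for a b c d
      using bi_ideal_down[OF \<open>bi_ideal I\<close> that(1)] bi_ideal_down[OF \<open>bi_ideal J\<close> that(2)] by simp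
    ultimately show "I \<subseteq> {(a, b). \<forall>c d. (c, d) \<in> J \<longrightarrow> (inf a c, inf b d) \<in> K}"
      by blast
  qed
qed

instance product_opens :: (frame, frame) frame
proof
  fix J :: "('a, 'b) product_opens" and B
  have "Sup B \<le> product_imp J (SUP I\<in>B. inf J I)"
    by (rule Sup_least) (simp add: product_imp_iff SUP_upper)
  then show "inf J (Sup B) = (SUP I\<in>B. inf J I)"
    by (intro antisym) (auto simp: product_imp_iff intro: SUP_least le_infI2 Sup_upper)
qed

text \<open>The open rectangle \<open>U \<times> V\<close>. Pairs with a bottom component lie in every bi-ideal (empty joins),
  so they have to be added.\<close>

lift_definition rectangle :: "'a::frame \<Rightarrow> 'b::frame \<Rightarrow> ('a, 'b) product_opens"
  is "\<lambda>U V. {(a, b). a \<le> U \<and> b \<le> V \<or> a = bot \<or> b = bot}"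
proof -
  fix U :: 'a and V :: 'b
  show "bi_ideal {(a, b). a \<le> U \<and> b \<le> V \<or> a = bot \<or> b = bot}"
  proof (rule bi_idealI)
    fix A :: "'a set" and b :: 'b
    assume *: "\<And>a. a \<in> A \<Longrightarrow> (a, b) \<in> {(a, b). a \<le> U \<and> b \<le> V \<or> a = bot \<or> b = bot}"
    show "(Sup A, b) \<in> {(a, b). a \<le> U \<and> b \<le> V \<or> a = bot \<or> b = bot}"
    proof (cases "b \<le> V \<and> b \<noteq> bot")
      case True
      with * have "Sup A \<le> U" by (intro Sup_least) fastforce
      with True show ?thesis by simp
    next
      case False
      with * have "b = bot \<or> Sup A = bot" by (auto simp: Sup_bot_conv)
      then show ?thesis by auto
    qed
  next
    fix a :: 'a and B :: "'b set"
    assume *: "\<And>b. b \<in> B \<Longrightarrow> (a, b) \<in> {(a, b). a \<le> U \<and> b \<le> V \<or> a = bot \<or> b = bot}"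
    show "(a, Sup B) \<in> {(a, b). a \<le> U \<and> b \<le> V \<or> a = bot \<or> b = bot}"
    proof (cases "a \<le> U \<and> a \<noteq> bot")
      case True
      with * have "Sup B \<le> V" by (intro Sup_least) fastforce
      with True show ?thesis by simp
    next
      case False
      with * have "a = bot \<or> Sup B = bot" by (auto simp: Sup_bot_conv)
      then show ?thesis by auto
    qed
  qed (auto intro: order_trans simp: bot_unique)
qed

text \<open>Inverse image maps of the two projections.\<close>

definition pr1 :: "'a::frame \<Rightarrow> ('a, 'b::frame) product_opens" where
  "pr1 U = rectangle U top"

definition pr2 :: "'b::frame \<Rightarrow> ('a::frame, 'b) product_opens" where
  "pr2 V = rectangle top V"

lemma rectangle_le_iff: "rectangle a b \<le> I \<longleftrightarrow> (a, b) \<in> pairs_of I"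
proof transfer
  fix a :: 'a and b :: 'b and I :: "('a \<times> 'b) set"
  assume "bi_ideal I"
  then show "{(a', b'). a' \<le> a \<and> b' \<le> b \<or> a' = bot \<or> b' = bot} \<subseteq> I \<longleftrightarrow> (a, b) \<in> I"
    by (auto intro: bi_ideal_down bi_ideal_bot)
qed

lemma pr1_inf_pr2: "inf (pr1 U) (pr2 V) = rectangle U V"
  unfolding pr1_def pr2_def by transfer auto

lemma Sup_rectangles: "(SUP (a, b)\<in>pairs_of I. rectangle a b) = I"
proof (rule antisym)
  show "(SUP (a, b)\<in>pairs_of I. rectangle a b) \<le> I"
    by (rule SUP_least) (auto simp: rectangle_le_iff)
  have "(a, b) \<in> pairs_of (SUP (a, b)\<in>pairs_of I. rectangle a b)" if "(a, b) \<in> pairs_of I" for a b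
    unfolding rectangle_le_iff[symmetric] by (rule SUP_upper2[OF that]) simp
  then show "I \<le> (SUP (a, b)\<in>pairs_of I. rectangle a b)"
    unfolding less_eq_product_opens.rep_eq by auto
qed

lemma preserves_joins_if_left_adjoint: "left_adjoint l f \<Longrightarrow> preserves_joins l"
  for l :: "'a::complete_lattice \<Rightarrow> 'b::complete_lattice"
  unfolding preserves_joins_def
proof
  fix A
  assume "left_adjoint l f"
  then have l: "l x \<le> y \<longleftrightarrow> x \<le> f y" for x y by (simp add: left_adjoint_def)
  have "l (Sup A) \<le> y \<longleftrightarrow> (SUP a\<in>A. l a) \<le> y" for y
    by (simp add: l Sup_le_iff)
  then show "l (Sup A) = (SUP a\<in>A. l a)" by (meson order.antisym order.refl)
qed

lemma frame_hom_pr1: "frame_hom (pr1 :: 'a::frame \<Rightarrow> ('a, 'b::frame) product_opens)"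
proof -
  have "pr1 (Sup A) = (SUP a\<in>A. pr1 a :: ('a, 'b) product_opens)" for A :: "'a set"
  proof (rule antisym)
    have "(Sup A, top) \<in> pairs_of (SUP a\<in>A. pr1 a :: ('a, 'b) product_opens)"
      by (rule bi_ideal_Sup1) (use pairs_of in \<open>auto simp: rectangle_le_iff[symmetric] pr1_def
        intro: SUP_upper\<close>)
    then show "pr1 (Sup A) \<le> (SUP a\<in>A. pr1 a :: ('a, 'b) product_opens)"
      by (simp add: pr1_def rectangle_le_iff)
    show "(SUP a\<in>A. pr1 a :: ('a, 'b) product_opens) \<le> pr1 (Sup A)"
      by (rule SUP_least) (auto simp: pr1_def rectangle_le_iff rectangle.rep_eq Sup_upper)
  qed
  moreover have "pr1 top = (top :: ('a, 'b) product_opens)"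
    unfolding pr1_def by transfer auto
  moreover have "pr1 (inf a b) = (inf (pr1 a) (pr1 b) :: ('a, 'b) product_opens)" for a b :: 'a
    unfolding pr1_def by transfer auto
  ultimately show ?thesis unfolding frame_hom_def preserves_joins_def by blast
qed

lemma frame_hom_pr2: "frame_hom (pr2 :: 'b::frame \<Rightarrow> ('a::frame, 'b) product_opens)"
proof -
  have "pr2 (Sup A) = (SUP a\<in>A. pr2 a :: ('a, 'b) product_opens)" for A :: "'b set"
  proof (rule antisym)
    have "(top, Sup A) \<in> pairs_of (SUP a\<in>A. pr2 a :: ('a, 'b) product_opens)"
      by (rule bi_ideal_Sup2) (use pairs_of in \<open>auto simp: rectangle_le_iff[symmetric] pr2_def
        intro: SUP_upper\<close>)
    then show "pr2 (Sup A) \<le> (SUP a\<in>A. pr2 a :: ('a, 'b) product_opens)"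
      by (simp add: pr2_def rectangle_le_iff)
    show "(SUP a\<in>A. pr2 a :: ('a, 'b) product_opens) \<le> pr2 (Sup A)"
      by (rule SUP_least) (auto simp: pr2_def rectangle_le_iff rectangle.rep_eq Sup_upper)
  qed
  moreover have "pr2 top = (top :: ('a, 'b) product_opens)"
    unfolding pr2_def by transfer auto
  moreover have "pr2 (inf a b) = (inf (pr2 a) (pr2 b) :: ('a, 'b) product_opens)" for a b :: 'b
    unfolding pr2_def by transfer auto
  ultimately show ?thesis unfolding frame_hom_def preserves_joins_def by blast
qed

lemma frame_hom_mono: "frame_hom f \<Longrightarrow> a \<le> b \<Longrightarrow> f a \<le> f b"
  unfolding frame_hom_def by (metis inf.absorb_iff1)

theorem product_opens_universal:
  fixes f :: "'a::frame \<Rightarrow> 'c::frame" and g :: "'b::frame \<Rightarrow> 'c"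
  assumes f: "frame_hom f" and g: "frame_hom g"
  shows "\<exists>!h. frame_hom h \<and> h \<circ> pr1 = f \<and> h \<circ> (pr2 :: 'b \<Rightarrow> ('a, 'b) product_opens) = g"
proof
  let ?h = "\<lambda>I :: ('a, 'b) product_opens. SUP (a, b)\<in>pairs_of I. inf (f a) (g b)"
  have fbot: "f bot = bot" and gbot: "g bot = bot"
    using f g unfolding frame_hom_def preserves_joins_def by (metis Sup_empty image_empty)+
  have ftop: "f top = top" and gtop: "g top = top"
    using f g unfolding frame_hom_def by auto
  have finf: "f (inf a b) = inf (f a) (f b)" and fSup: "f (Sup A) = (SUP a\<in>A. f a)" for a b A
    using f unfolding frame_hom_def preserves_joins_def by auto
  have ginf: "g (inf a b) = inf (g a) (g b)" and gSup: "g (Sup A) = (SUP a\<in>A. g a)" for a b A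
    using g unfolding frame_hom_def preserves_joins_def by auto
  have ideal: "bi_ideal {(a, b). inf (f a) (g b) \<le> c}" for c
  proof (rule bi_idealI)
    fix a a' :: 'a and b b' :: 'b
    assume "(a, b) \<in> {(a, b). inf (f a) (g b) \<le> c}" "a' \<le> a" "b' \<le> b"
    then show "(a', b') \<in> {(a, b). inf (f a) (g b) \<le> c}"
      by (auto intro: order_trans[OF inf_mono[OF frame_hom_mono[OF f] frame_hom_mono[OF g]]])
  qed (auto simp: fSup gSup inf_Sup_frame SUP_inf_frame image_image intro!: SUP_least)
  have "left_adjoint ?h (\<lambda>c. Abs_product_opens {(a, b). inf (f a) (g b) \<le> c})"
    unfolding left_adjoint_def less_eq_product_opens.rep_eq
    using ideal by (auto simp: Abs_product_opens_inverse SUP_le_iff)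
  then have "preserves_joins ?h" by (rule preserves_joins_if_left_adjoint)
  moreover have "?h top = top"
  proof (rule top_le)
    show "top \<le> ?h top"
      by (rule SUP_upper2[of "(top, top)"]) (auto simp: ftop gtop top_product_opens.rep_eq)
  qed
  moreover have "?h (inf I J) = inf (?h I) (?h J)" for I J
  proof (rule antisym)
    show "?h (inf I J) \<le> inf (?h I) (?h J)"
      by (intro le_infI SUP_subset_mono) (auto simp: inf_product_opens.rep_eq)
    have "inf (inf (f a) (g b)) (inf (f a') (g b')) \<le> ?h (inf I J)"
      if "(a, b) \<in> pairs_of I" "(a', b') \<in> pairs_of J" for a b a' b'
    proof (rule SUP_upper2[of "(inf a a', inf b b')"])
      show "(inf a a', inf b b') \<in> pairs_of (inf I J)"
        using that pairs_of[of I] pairs_of[of J] by (auto simp: inf_product_opens.rep_eq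
          intro: bi_ideal_down)
    qed (auto simp: finf ginf intro: le_infI1 le_infI2)
    then show "inf (?h I) (?h J) \<le> ?h (inf I J)"
      by (auto simp: inf_Sup_frame SUP_inf_frame image_image SUP_le_iff split_beta)
  qed
  ultimately have "frame_hom ?h" unfolding frame_hom_def by blast
  moreover have "?h (pr1 U) = f U" for U
  proof (rule antisym)
    show "?h (pr1 U) \<le> f U"
      by (rule SUP_least)
        (auto simp: pr1_def rectangle.rep_eq fbot gbot intro: le_infI1 frame_hom_mono[OF f])
    show "f U \<le> ?h (pr1 U)"
      by (rule SUP_upper2[of "(U, top)"]) (auto simp: pr1_def rectangle.rep_eq gtop)
  qed
  moreover have "?h (pr2 V) = g V" for V
  proof (rule antisym)
    show "?h (pr2 V) \<le> g V"
      by (rule SUP_least)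
        (auto simp: pr2_def rectangle.rep_eq fbot gbot intro: le_infI2 frame_hom_mono[OF g])
    show "g V \<le> ?h (pr2 V)"
      by (rule SUP_upper2[of "(top, V)"]) (auto simp: pr2_def rectangle.rep_eq ftop)
  qed
  ultimately show "frame_hom ?h \<and> ?h \<circ> pr1 = f \<and> ?h \<circ> pr2 = g" by auto
next
  fix h
  assume h: "frame_hom h \<and> h \<circ> pr1 = f \<and> h \<circ> (pr2 :: 'b \<Rightarrow> ('a, 'b) product_opens) = g"
  have rect: "h (rectangle a b) = inf (f a) (g b)" for a b
    using h unfolding pr1_inf_pr2[symmetric] frame_hom_def by auto
  have "h I = (SUP (a, b)\<in>pairs_of I. inf (f a) (g b))" for I
  proof -
    have "h I = h (SUP (a, b)\<in>pairs_of I. rectangle a b)" by (simp add: Sup_rectangles)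
    also have "\<dots> = (SUP (a, b)\<in>pairs_of I. h (rectangle a b))"
      using h unfolding frame_hom_def preserves_joins_def by (simp add: image_image split_beta)
    finally show ?thesis by (simp add: rect)
  qed
  then show "h = (\<lambda>I. SUP (a, b)\<in>pairs_of I. inf (f a) (g b))" by auto
qed

text \<open>A localic relation \<open>r : R \<rightarrow> X \<times> X\<close>, given by \<open>r\<^sup>-\<^sup>1\<close>. The opens of \<open>R\<close> form an arbitrary
  frame \<open>'r\<close>.\<close>

definition localic_relation :: "(('a::frame, 'a) product_opens \<Rightarrow> 'r::frame) \<Rightarrow> bool" where
  "localic_relation r \<longleftrightarrow> frame_hom r \<and> surj r"

definition source_map :: "(('a::frame, 'a) product_opens \<Rightarrow> 'r::frame) \<Rightarrow> 'a \<Rightarrow> 'r" where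
  "source_map r = r \<circ> pr1"

definition target_map :: "(('a::frame, 'a) product_opens \<Rightarrow> 'r::frame) \<Rightarrow> 'a \<Rightarrow> 'r" where
  "target_map r = r \<circ> pr2"

definition open_cones :: "(('a::frame, 'a) product_opens \<Rightarrow> 'r::frame) \<Rightarrow> bool" where
  "open_cones r \<longleftrightarrow> open_map (source_map r) \<and> open_map (target_map r)"

definition up_cone :: "(('a::frame, 'a) product_opens \<Rightarrow> 'r::frame) \<Rightarrow> 'a \<Rightarrow> 'a" where
  "up_cone r = direct_image (target_map r) \<circ> source_map r"

definition down_cone :: "(('a::frame, 'a) product_opens \<Rightarrow> 'r::frame) \<Rightarrow> 'a \<Rightarrow> 'a" where
  "down_cone r = direct_image (source_map r) \<circ> target_map r"

end

theory Submission
  imports Defs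
begin

text \<open>Each cone is an inverse image followed by a direct image. The inverse image is a frame
  map, so it preserves joins by definition; the direct image is a left adjoint
  (\<open>left_adjoint_direct_image\<close>), so it preserves joins by
  \<open>preserves_joins_if_left_adjoint\<close>. Composites inherit the property.\<close>

lemma left_adjoint_direct_image:
  assumes "open_map f"
  shows "left_adjoint (direct_image f) f"
proof -
  obtain l where l: "left_adjoint l f"
    using assms unfolding open_map_def by blast
  \<comment> \<open>Left adjoints are unique, so the definite description in
    \<open>direct_image\<close> denotes the adjoint that openness provides.\<close>
  then have "direct_image f = l"
    unfolding direct_image_def by (blast intro: the_equality left_adjoint_unique)
  with l show ?thesis by simp
qed

lemma preserves_joins_comp:
  assumes "preserves_joins g" "preserves_joins f"
  shows "preserves_joins (g \<circ> f)"
  using assms by (simp add: preserves_joins_def image_image)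

text \<open>Treats both cones at once: \<open>f\<close> and \<open>g\<close> are the target and
  source maps for \<open>up_cone\<close>, and the reverse for \<open>down_cone\<close>.\<close>

lemma preserves_joins_direct_image_comp:
  assumes "open_map f" "open_map g"
  shows "preserves_joins (direct_image f \<circ> g)"
proof (rule preserves_joins_comp)
  show "preserves_joins (direct_image f)"
    by (rule preserves_joins_if_left_adjoint[OF left_adjoint_direct_image[OF assms(1)]])
  show "preserves_joins g"
    using assms(2) by (simp add: open_map_def frame_hom_def)
qed

theorem proposition6p3:
  fixes r :: "('a::frame, 'a) product_opens \<Rightarrow> 'r::frame"
  assumes "localic_relation r" and "open_cones r"
  shows "preserves_joins (up_cone r) \<and> preserves_joins (down_cone r)"
  using assms(2) unfolding open_cones_def up_cone_def down_cone_def
  by (simp add: preserves_joins_direct_image_comp)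

end
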